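(* Let $n\ge1$ and let $K\in\mathbb R^{n\times n}$ be a matrix with nonnegative entries, normalized so that its spectral norm satisfies $\|K\|\le 1$. Then the inner loop of the Stable Adaptive Local Iterative Filtering (SALIF) algorithm always converges: for every $\bm g_1\in\mathbb R^n$, the sequence defined by $$\bm g_{m+1}=(I-K^TK)\,\bm g_m,\qquad m\ge 1,$$ converges as $m\to\infty$.
   Context: In the SALIF algorithm, a signal on $[0,1]$ is sampled as a vector in $\mathbb R^n$ at the points $x_i=i/n$, and the moving average is represented by the matrix $K=\big[\tfrac1n k_{x_i}(x_i-x_j)\big]_{i,j=0}^{n-1}$, where $k_x(z)=k(z/\ell(x))/\ell(x)$, $k$ is an even, nonnegative, bounded, measurable function supported in $[-1,1]$ with unit integral, and $\ell$ is a positive function on $[0,1]$. The matrix is then multiplied by a positive constant so that its spectral norm is at most $1$. $I$ is the $n\times n$ identity matrix. *)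

theory Defs
  imports "HOL-Analysis.Analysis"
begin

text \<open>
  The spectral norm is the operator norm induced by the Euclidean norm, and the norm on
  \<^typ>\<open>real ^ 'n\<close> is Euclidean.  The library's \<^const>\<open>norm\<close> on \<^typ>\<open>real ^ 'n ^ 'n\<close> is instead
  the Frobenius norm.
\<close>
definition spectral_norm :: "real ^ 'n ^ 'm \<Rightarrow> real"
  where "spectral_norm A = onorm (\<lambda>x. A *v x)"

end

theory Submission
  imports Defs
begin

text \<open>
  For \<open>A = K\<^sup>T K\<close> with \<open>\<parallel>K\<parallel> \<le> 1\<close> one has \<open>\<parallel>A x\<parallel>\<^sup>2 \<le> \<parallel>K x\<parallel>\<^sup>2 = \<langle>x, A x\<rangle>\<close>; this
  inequality alone forces the powers of \<open>I - A\<close> to converge.  It gives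
  \<open>\<parallel>x - A x\<parallel>\<^sup>2 \<le> \<parallel>x\<parallel>\<^sup>2 - \<parallel>A x\<parallel>\<^sup>2\<close>, so \<open>A (I - A)\<^sup>m w \<longlongrightarrow> 0\<close> for every \<open>w\<close>: the powers tend
  to \<open>0\<close> on the range of \<open>A\<close>.  A vector \<open>z\<close> orthogonal to that range satisfies
  \<open>\<parallel>A z\<parallel>\<^sup>2 \<le> \<langle>z, A z\<rangle> = 0\<close>, so the powers fix it.
\<close>

lemma norm_diff_sq_le_of_cocoercive:
  fixes f :: "'a::real_inner \<Rightarrow> 'a"
  assumes "(norm (f x))\<^sup>2 \<le> x \<bullet> f x"
  shows "(norm (x - f x))\<^sup>2 \<le> (norm x)\<^sup>2 - (norm (f x))\<^sup>2"
  using assms by (simp add: power2_norm_eq_inner inner_diff inner_commute)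

text \<open>The squared norms of the iterates decrease and are bounded below by 0, hence converge.
  Their successive drops therefore tend to 0, and each drop dominates the squared residual.\<close>

lemma cocoercive_iteration_residual_tendsto_0:
  fixes f :: "'a::real_inner \<Rightarrow> 'a"
  assumes coc: "\<And>x. (norm (f x))\<^sup>2 \<le> x \<bullet> f x"
    and step: "\<And>m. w (Suc m) = w m - f (w m)"
  shows "(\<lambda>m. f (w m)) \<longlonglongrightarrow> 0"
proof -
  define a where "a m = (norm (w m))\<^sup>2" for m
  have drop: "(norm (f (w m)))\<^sup>2 \<le> a m - a (Suc m)" for m
    using norm_diff_sq_le_of_cocoercive[of f "w m", OF coc] by (simp add: a_def step)
  have "a (Suc m) \<le> a m" for m
    using drop[of m] zero_le_power2[of "norm (f (w m))"] by linarith
  then have "decseq a"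
    by (rule decseq_SucI)
  moreover have "0 \<le> a m" for m
    by (simp add: a_def)
  ultimately obtain L where L: "a \<longlonglongrightarrow> L"
    using decseq_convergent by blast
  have "(\<lambda>m. a m - a (Suc m)) \<longlonglongrightarrow> 0"
    using tendsto_diff[OF L LIMSEQ_Suc[OF L]] by simp
  then have "(\<lambda>m. (norm (f (w m)))\<^sup>2) \<longlonglongrightarrow> 0"
    by (rule Lim_null_comparison[rotated]) (use drop in simp)
  then have "(\<lambda>m. sqrt ((norm (f (w m)))\<^sup>2)) \<longlonglongrightarrow> sqrt 0"
    by (rule tendsto_real_sqrt)
  then show ?thesis
    by (simp add: tendsto_norm_zero_iff)
qed

lemma cocoercive_linear_iteration_convergent:
  fixes f :: "'a::euclidean_space \<Rightarrow> 'a"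
  assumes lin: "linear f"
    and coc: "\<And>x. (norm (f x))\<^sup>2 \<le> x \<bullet> f x"
    and step: "\<And>m. g (Suc m) = g m - f (g m)"
  shows "convergent g"
proof -
  have "subspace (range f)"
    using lin by (simp add: linear_subspace_image)
  then have span: "span (range f) = range f"
    by (simp add: span_eq_iff)
  obtain y z where y: "y \<in> range f" and z: "\<And>v. v \<in> range f \<Longrightarrow> orthogonal z v"
    and g0: "g 0 = y + z"
    using orthogonal_subspace_decomp_exists[of "range f" "g 0"] unfolding span by blast
  obtain w0 where w0: "y = f w0"
    using y by blast
  have "(norm (f z))\<^sup>2 \<le> 0"
    using coc[of z] z[of "f z"] by (simp add: orthogonal_def)
  then have fz: "f z = 0"
    by simp
  define w where "w m = ((\<lambda>x. x - f x) ^^ m) w0" for m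
  have w_Suc: "w (Suc m) = w m - f (w m)" for m
    by (simp add: w_def)
  \<comment> \<open>By linearity \<open>f\<close> commutes with \<open>\<lambda>x. x - f x\<close>,
    so the orbit of \<open>f w0\<close> is the image under \<open>f\<close> of the orbit of
    \<open>w0\<close>; \<open>z\<close> is carried along unchanged.\<close>
  have g_eq: "g m = f (w m) + z" for m
  proof (induction m)
    case 0
    show ?case
      using g0 w0 by (simp add: w_def)
  next
    case (Suc m)
    then show ?case
      by (simp add: step w_Suc linear_add[OF lin] linear_diff[OF lin] fz)
  qed
  have "g \<longlonglongrightarrow> 0 + z"
    unfolding g_eq
    by (intro tendsto_add tendsto_const cocoercive_iteration_residual_tendsto_0 coc w_Suc)
  then show ?thesis
    by (rule convergentI)
qed

lemma norm_matrix_vector_le_spectral_norm: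
  fixes A :: "real ^ 'n ^ 'm"
  shows "norm (A *v x) \<le> spectral_norm A * norm x"
  unfolding spectral_norm_def by (rule onorm[OF matrix_vector_mul_bounded_linear])

text \<open>Duality: move one transpose across the inner product, apply Cauchy-Schwarz, and cancel a
  factor \<open>norm (transpose A *v x)\<close>.\<close>

lemma norm_transpose_matrix_vector_le:
  fixes A :: "real ^ 'n ^ 'm"
  shows "norm (transpose A *v x) \<le> spectral_norm A * norm x"
proof (cases "transpose A *v x = 0")
  case True
  have "0 \<le> spectral_norm A"
    unfolding spectral_norm_def by (rule onorm_pos_le[OF matrix_vector_mul_bounded_linear])
  then show ?thesis
    using True by simp
next
  case False
  let ?y = "transpose A *v x"
  have "norm ?y * norm ?y = x \<bullet> (A *v ?y)"
    by (metis dot_lmul_matrix inner_commute power2_norm_eq_inner power2_eq_square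
        transpose_matrix_vector)
  also have "\<dots> \<le> norm x * norm (A *v ?y)"
    by (rule norm_cauchy_schwarz)
  also have "\<dots> \<le> norm x * (spectral_norm A * norm ?y)"
    by (intro mult_left_mono norm_matrix_vector_le_spectral_norm norm_ge_zero)
  finally have "norm ?y * norm ?y \<le> (spectral_norm A * norm x) * norm ?y"
    by (simp add: mult_ac)
  then show ?thesis
    using False by simp
qed

lemma gram_matrix_cocoercive:
  fixes K :: "real ^ 'n ^ 'm"
  assumes "spectral_norm K \<le> 1"
  shows "(norm ((transpose K ** K) *v x))\<^sup>2 \<le> x \<bullet> ((transpose K ** K) *v x)"
proof -
  have "norm (transpose K *v (K *v x)) \<le> spectral_norm K * norm (K *v x)"
    by (rule norm_transpose_matrix_vector_le)
  also have "\<dots> \<le> norm (K *v x)"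
    using mult_right_mono[OF assms norm_ge_zero] by simp
  finally have "(norm (transpose K *v (K *v x)))\<^sup>2 \<le> (norm (K *v x))\<^sup>2"
    by (simp add: power_mono)
  also have "(norm (K *v x))\<^sup>2 = x \<bullet> (transpose K *v (K *v x))"
    by (metis dot_lmul_matrix inner_commute power2_norm_eq_inner transpose_matrix_vector)
  finally show ?thesis
    by (simp add: matrix_vector_mul_assoc)
qed

theorem mainTheorem2:
  fixes K :: "real ^ 'n ^ 'n"
    and g1 :: "real ^ 'n"
    and g :: "nat \<Rightarrow> real ^ 'n"
  assumes nonneg: "\<And>i j. K $ i $ j \<ge> 0"
    and normalized: "spectral_norm K \<le> 1"
    and init: "g 1 = g1"
    and step: "\<And>m. m \<ge> 1 \<Longrightarrow> g (m + 1) = (mat 1 - transpose K ** K) *v g m"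
  shows "convergent g"
proof -
  \<comment> \<open>The recurrence starts at index 1 and leaves \<open>g 0\<close> arbitrary, so the
    iteration lemma is applied to the shifted sequence.\<close>
  have "g (Suc (Suc m)) = g (Suc m) - (transpose K ** K) *v g (Suc m)" for m
    using step[of "Suc m"] by (simp add: matrix_vector_mult_diff_rdistrib)
  then have "convergent (\<lambda>m. g (Suc m))"
    by (rule cocoercive_linear_iteration_convergent
        [OF matrix_vector_mul_linear gram_matrix_cocoercive[OF normalized]])
  then show ?thesis
    by (simp add: convergent_Suc_iff)
qed

end
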